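(* Let $A,B:\mathbb{R}^m_{>0}\to\mathbb{S}^n$ be affine symmetric-matrix-valued functions, $A(\boldsymbol{x})=A_0+\sum_{e=1}^m x_eA_e$ and $B(\boldsymbol{x})=B_0+\sum_{e=1}^m x_eB_e$ with constant matrices $A_e,B_e\in\mathbb{S}^n$ $(e=0,\ldots,m)$, and suppose $B(\boldsymbol{x})\succ 0$ for every $\boldsymbol{x}\in\mathbb{R}^m_{>0}$. Then the maximum generalized eigenvalue function $\lambda_1^{A,B}:\mathbb{R}^m_{>0}\to\mathbb{R}$, $\boldsymbol{x}\mapsto\lambda_1(A(\boldsymbol{x}),B(\boldsymbol{x}))$, is pseudoconvex on $\mathbb{R}^m_{>0}$.
   Context: $\mathbb{R}^m_{>0}$ is the set of real $m$-vectors with all components positive; $\mathbb{S}^n$ is the space of real symmetric $n\times n$ matrices; $X\succ0$ means positive definite. Generalized eigenvalues: for $X,Y\in\mathbb{S}^n$ with $Y\succ 0$, the generalized eigenvalues of $(X,Y)$ are the $\lambda_i\in\mathbb{R}$ with $X\boldsymbol{v}_i=\lambda_iY\boldsymbol{v}_i$ for some nonzero $\boldsymbol{v}_i\in\mathbb{R}^n$; with multiplicity there are $n$ of them, ordered $\lambda_1(X,Y)\ge\cdots\ge\lambda_n(X,Y)$. Clarke subdifferential: for a locally Lipschitz continuous function $f$ on an open subset of $\mathbb{R}^m$, $\partial f(\boldsymbol{x})$ is the convex hull of all limits $\lim_{i\to\infty}\nabla f(\boldsymbol{x}^i)$ taken over sequences $\boldsymbol{x}^i\to\boldsymbol{x}$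 of points at which $f$ is differentiable and for which the limit exists. Pseudoconvexity: for a nonempty convex set $D\subset\mathbb{R}^m$, a locally Lipschitz continuous function $f:D\to\mathbb{R}$ is pseudoconvex if for all $\boldsymbol{x},\boldsymbol{y}\in D$ and all $\boldsymbol{g}\in\partial f(\boldsymbol{x})$, $f(\boldsymbol{x})>f(\boldsymbol{y})$ implies $\langle\boldsymbol{g},\boldsymbol{y}-\boldsymbol{x}\rangle<0$. *)

theory Defs
  imports "HOL-Analysis.Analysis"
begin

definition pos_orthant :: "(real ^ 'm) set" where
  "pos_orthant = {x. \<forall>e. 0 < x $ e}"

definition symmetric_mat :: "real ^ 'n ^ 'n \<Rightarrow> bool" where
  "symmetric_mat X \<longleftrightarrow> transpose X = X"

definition pos_def_mat :: "real ^ 'n ^ 'n \<Rightarrow> bool" where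
  "pos_def_mat X \<longleftrightarrow> symmetric_mat X \<and> (\<forall>v. v \<noteq> 0 \<longrightarrow> 0 < v \<bullet> (X *v v))"

definition gen_eigenvalue :: "real ^ 'n ^ 'n \<Rightarrow> real ^ 'n ^ 'n \<Rightarrow> real \<Rightarrow> bool" where
  "gen_eigenvalue X Y l \<longleftrightarrow> (\<exists>v. v \<noteq> 0 \<and> X *v v = l *\<^sub>R (Y *v v))"

(* The largest entry of the decreasingly ordered list of generalized eigenvalues does not
   depend on multiplicities. The set below is finite and nonempty whenever X is symmetric
   and Y is positive definite; Max carries no information otherwise. *)
definition max_gen_eigenvalue :: "real ^ 'n ^ 'n \<Rightarrow> real ^ 'n ^ 'n \<Rightarrow> real" where
  "max_gen_eigenvalue X Y = Max {l. gen_eigenvalue X Y l}"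

definition locally_lipschitz_on :: "'a::metric_space set \<Rightarrow> ('a \<Rightarrow> 'b::metric_space) \<Rightarrow> bool" where
  "locally_lipschitz_on D f \<longleftrightarrow>
     (\<forall>x\<in>D. \<exists>u>0. \<exists>L. L-lipschitz_on (cball x u \<inter> D) f)"

(* Meant for open D and f locally Lipschitz on D: then differentiability at points of D, and
   hence this set for x in D, does not depend on the values of f outside D. *)
definition clarke_subdifferential ::
    "'a::euclidean_space set \<Rightarrow> ('a \<Rightarrow> real) \<Rightarrow> 'a \<Rightarrow> 'a set" where
  "clarke_subdifferential D f x = convex hull
     {g. \<exists>X G. (\<forall>i::nat. X i \<in> D \<and> GDERIV f (X i) :> G i) \<and>
               X \<longlonglongrightarrow> x \<and> G \<longlonglongrightarrow> g}"

(* Openness of D is required because the Clarke subdifferential is only defined there. *)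
definition pseudoconvex_on :: "'a::euclidean_space set \<Rightarrow> ('a \<Rightarrow> real) \<Rightarrow> bool" where
  "pseudoconvex_on D f \<longleftrightarrow>
     open D \<and> convex D \<and> D \<noteq> {} \<and> locally_lipschitz_on D f \<and>
     (\<forall>x\<in>D. \<forall>y\<in>D. \<forall>g\<in>clarke_subdifferential D f x.
        f x > f y \<longrightarrow> g \<bullet> (y - x) < 0)"

end

theory Submission
  imports Defs
begin

text \<open>The largest generalized eigenvalue is the maximum of the Rayleigh quotient, attained at some
  unit vector \<^term>\<open>v\<close>. Let \<^term>\<open>f\<close> be differentiable at \<^term>\<open>x\<close> with
  \<^term>\<open>f y \<le> f x\<close>. Testing the Rayleigh quotient at the point \<^term>\<open>x + s *\<^sub>R (x - y)\<close>,
  beyond \<^term>\<open>x\<close> as seen from \<^term>\<open>y\<close>, with the maximizer \<^term>\<open>v\<close> for \<^term>\<open>x\<close>,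
  shows that \<^term>\<open>f\<close> grows there at a rate of at least
  \<^term>\<open>(f x - f y) * b / norm (B x)\<close>, where \<^term>\<open>b\<close> bounds the form of \<^term>\<open>B y\<close> from
  below on the unit sphere. This estimate is stable under limits of gradients, and it confines them
  to an open half-space, hence also their convex hull.\<close>

abbreviation quad_form :: "real ^ 'n ^ 'n \<Rightarrow> real ^ 'n \<Rightarrow> real" where
  "quad_form M v \<equiv> v \<bullet> (M *v v)"

section \<open>Quadratic forms\<close>

lemma symmetric_mat_inner:
  assumes "symmetric_mat M"
  shows "v \<bullet> (M *v w) = (M *v v) \<bullet> w"
  using assms by (metis symmetric_mat_def dot_lmul_matrix vector_transpose_matrix)

lemma quad_form_scaleR_right: "quad_form M (c *\<^sub>R v) = c\<^sup>2 * quad_form M v"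
  by (simp add: matrix_vector_mult_scaleR power2_eq_square)

lemma quad_form_add: "quad_form (M + N) v = quad_form M v + quad_form N v"
  and quad_form_diff: "quad_form (M - N) v = quad_form M v - quad_form N v"
  and quad_form_scaleR: "quad_form (c *\<^sub>R M) v = c * quad_form M v"
  by (simp_all add: matrix_vector_mult_add_rdistrib matrix_vector_mult_diff_rdistrib
      inner_add_right inner_diff_right flip: scaleR_matrix_vector_assoc)

text \<open>On this type \<open>norm M\<close> is the Frobenius norm, so Cauchy-Schwarz on each row
  suffices.\<close>

lemma norm_matrix_vector_mult_le:
  fixes M :: "real ^ 'n ^ 'm"
  shows "norm (M *v v) \<le> norm M * norm v"
proof -
  have "norm (M *v v) \<le> L2_set (\<lambda>i. norm (M $ i) * norm v) UNIV"
    unfolding norm_vec_def[of "M *v v"]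
    by (rule L2_set_mono) (simp_all add: matrix_vector_mul_component Cauchy_Schwarz_ineq2)
  also have "\<dots> = norm M * norm v"
    unfolding norm_vec_def[of M] by (simp add: L2_set_left_distrib)
  finally show ?thesis .
qed

lemma abs_quad_form_le:
  assumes "norm v = 1"
  shows "\<bar>quad_form M v\<bar> \<le> norm M"
  using Cauchy_Schwarz_ineq2[of v "M *v v"] norm_matrix_vector_mult_le[of M v] assms by simp

lemma continuous_on_quad_form: "continuous_on S (quad_form M)"
  by (intro continuous_intros linear_continuous_on matrix_vector_mul_bounded_linear)

lemma unit_sphere_nonempty: "sphere (0 :: real ^ 'n) 1 \<noteq> {}"
  by simp

lemma pos_def_mat_unit_pos: "pos_def_mat Y \<Longrightarrow> norm v = 1 \<Longrightarrow> 0 < quad_form Y v"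
  unfolding pos_def_mat_def by (metis norm_zero zero_neq_one)

text \<open>Compactness of the unit sphere makes positive definiteness quantitative: the minimum of
  the form is attained, hence positive.\<close>

lemma pos_def_mat_lower_bound:
  fixes Y :: "real ^ 'n ^ 'n"
  assumes "pos_def_mat Y"
  obtains b where "0 < b" "\<And>v. norm v = 1 \<Longrightarrow> b \<le> quad_form Y v"
proof -
  obtain v where v: "v \<in> sphere 0 1" "\<And>w. w \<in> sphere 0 1 \<Longrightarrow> quad_form Y v \<le> quad_form Y w"
    using continuous_attains_inf[OF compact_sphere unit_sphere_nonempty continuous_on_quad_form]
    by blast
  show ?thesis
  proof (rule that)
    show "0 < quad_form Y v"
      using v(1) assms by (simp add: pos_def_mat_unit_pos)
  qed (use v(2) in auto)
qed

text \<open>Along the line \<^term>\<open>v + t *\<^sub>R (M *v v)\<close> the form is a nonpositive quadratic in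
  \<^term>\<open>t\<close> without constant term, so its linear coefficient, twice the squared norm of
  \<^term>\<open>M *v v\<close>, vanishes.\<close>

lemma neg_semidef_isotropic_imp_kernel:
  assumes "symmetric_mat M" and neg: "\<And>w. quad_form M w \<le> 0" and "quad_form M v = 0"
  shows "M *v v = 0"
proof -
  define w where "w = M *v v"
  define q where "q = quad_form M w"
  have sym: "v \<bullet> (M *v w) = w \<bullet> w"
    using symmetric_mat_inner[OF assms(1)] w_def by metis
  have quad: "2 * t * (w \<bullet> w) + t\<^sup>2 * q \<le> 0" for t
  proof -
    have "quad_form M (v + t *\<^sub>R w) = quad_form M v + t * (v \<bullet> (M *v w)) + t * (w \<bullet> (M *v v)) + t\<^sup>2 * q"
      unfolding q_def
      by (simp add: matrix_vector_right_distrib matrix_vector_mult_scaleR inner_add_left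
          inner_add_right power2_eq_square algebra_simps)
    then show ?thesis
      using neg[of "v + t *\<^sub>R w"] assms(3) sym w_def by simp
  qed
  \<comment> \<open>The quadratic will be evaluated at \<open>t * (w \<bullet> w)\<close>. The
    factor \<open>w \<bullet> w\<close> can then be pulled out and leaves \<open>2 + t * q\<close>,
    which the choice of \<open>t\<close> keeps positive.\<close>
  define t where "t = 1 / (1 + \<bar>q\<bar>)"
  have "t > 0" "t * \<bar>q\<bar> < 1"
    unfolding t_def by (auto simp: divide_simps)
  show ?thesis
  proof (rule ccontr)
    assume "M *v v \<noteq> 0"
    then have pos: "w \<bullet> w > 0" unfolding w_def by simp
    define s where "s = t * (w \<bullet> w)"
    have "s > 0" using \<open>t > 0\<close> pos s_def by simp
    have "2 * s * (w \<bullet> w) + s\<^sup>2 * q \<le> 0" by (rule quad)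
    then have "s * (2 * (w \<bullet> w) + s * q) \<le> 0" by (simp add: power2_eq_square algebra_simps)
    then have "2 * (w \<bullet> w) + s * q \<le> 0" using \<open>s > 0\<close> by (simp add: mult_le_0_iff)
    then have "(w \<bullet> w) * (2 + t * q) \<le> 0" by (simp add: s_def algebra_simps)
    then have "2 + t * q \<le> 0" using pos by (simp add: mult_le_0_iff)
    moreover have "\<bar>t * q\<bar> < 1" using \<open>t > 0\<close> \<open>t * \<bar>q\<bar> < 1\<close> by (simp add: abs_mult)
    ultimately show False by linarith
  qed
qed

section \<open>The largest generalized eigenvalue as a maximal Rayleigh quotient\<close>

text \<open>Eigenvectors for distinct eigenvalues are orthogonal in the inner product given by
  \<open>Y\<close>, hence linearly independent. Finiteness is what gives \<open>Max\<close> its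
  meaning.\<close>

lemma finite_gen_eigenvalues:
  fixes X Y :: "real ^ 'n ^ 'n"
  assumes "symmetric_mat X" "pos_def_mat Y"
  shows "finite {l. gen_eigenvalue X Y l}"
proof -
  let ?E = "{l. gen_eigenvalue X Y l}"
  have symY: "symmetric_mat Y" and posY: "\<And>v. v \<noteq> 0 \<Longrightarrow> 0 < quad_form Y v"
    using assms(2) by (auto simp: pos_def_mat_def)
  have "\<forall>l\<in>?E. \<exists>v. v \<noteq> 0 \<and> X *v v = l *\<^sub>R (Y *v v)"
    by (simp add: gen_eigenvalue_def)
  then obtain e where e: "\<And>l. l \<in> ?E \<Longrightarrow> e l \<noteq> 0 \<and> X *v e l = l *\<^sub>R (Y *v e l)"
    unfolding bchoice_iff by blast
  have orth: "e k \<bullet> (Y *v e l) = 0" if "k \<in> ?E" "l \<in> ?E" "k \<noteq> l" for k l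
  proof -
    have "l * (e k \<bullet> (Y *v e l)) = e k \<bullet> (X *v e l)"
      unfolding e[OF that(2), THEN conjunct2] by simp
    also have "\<dots> = (X *v e k) \<bullet> e l" by (rule symmetric_mat_inner[OF assms(1)])
    also have "\<dots> = k * ((Y *v e k) \<bullet> e l)"
      unfolding e[OF that(1), THEN conjunct2] by simp
    also have "\<dots> = k * (e k \<bullet> (Y *v e l))"
      unfolding symmetric_mat_inner[OF symY] by simp
    finally show ?thesis using that(3) by simp
  qed
  have self: "e k \<bullet> (Y *v e k) \<noteq> 0" if "k \<in> ?E" for k
    using posY[of "e k"] e[OF that] by simp
  \<comment> \<open>Injectivity carries finiteness from the chosen eigenvectors back to the
    eigenvalues.\<close>
  have inj: "inj_on e ?E"
  proof (rule inj_onI, rule ccontr)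
    fix k l assume "k \<in> ?E" "l \<in> ?E" "e k = e l" "k \<noteq> l"
    then show False using orth[of k l] self[of l] by simp
  qed
  have "independent (e ` ?E)"
    unfolding dependent_def
  proof
    assume "\<exists>a\<in>e ` ?E. a \<in> span (e ` ?E - {a})"
    then obtain k where k: "k \<in> ?E" "e k \<in> span (e ` ?E - {e k})" by blast
    have "e k \<bullet> (Y *v w) = 0" if "w \<in> span (e ` ?E - {e k})" for w
      using that
    proof (induction rule: span_induct)
      case base
      show ?case
        by (auto simp: subspace_def matrix_vector_right_distrib matrix_vector_mult_scaleR
            inner_add_right)
    next
      case (step w)
      then obtain l where "l \<in> ?E" "l \<noteq> k" "w = e l" by blast
      then show ?case using orth[OF k(1)] by simp
    qed
    from this[OF k(2)] show False using self[OF k(1)] by contradiction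
  qed
  then have "finite (e ` ?E)" by (rule independent_imp_finite)
  then show ?thesis using inj finite_imageD by blast
qed

text \<open>If the Rayleigh quotient has maximum \<open>r\<close> at \<open>v\<close>, then
  \<open>X - r *\<^sub>R Y\<close> is negative semidefinite and isotropic at \<open>v\<close>. So
  \<open>v\<close> lies in its kernel, and \<open>r\<close> is an eigenvalue. No eigenvalue exceeds
  \<open>r\<close>, each being the quotient at its own eigenvector.\<close>

lemma max_gen_eigenvalue_quad_form:
  fixes X Y :: "real ^ 'n ^ 'n"
  assumes "symmetric_mat X" "pos_def_mat Y"
  defines "l \<equiv> max_gen_eigenvalue X Y"
  shows max_gen_eigenvalue_ge: "quad_form X w \<le> l * quad_form Y w"
    and max_gen_eigenvalue_attained: "\<exists>v. norm v = 1 \<and> quad_form X v = l * quad_form Y v"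
proof -
  have symY: "symmetric_mat Y" and posY: "\<And>v. v \<noteq> 0 \<Longrightarrow> 0 < quad_form Y v"
    using assms(2) by (auto simp: pos_def_mat_def)
  have "continuous_on (sphere 0 1) (\<lambda>v. quad_form X v / quad_form Y v)"
    using pos_def_mat_unit_pos[OF assms(2)]
    by (intro continuous_on_divide continuous_on_quad_form) force
  from continuous_attains_sup[OF compact_sphere unit_sphere_nonempty this]
  obtain v where v: "norm v = 1"
    "\<And>w. norm w = 1 \<Longrightarrow> quad_form X w / quad_form Y w \<le> quad_form X v / quad_form Y v"
    by auto
  have "v \<noteq> 0" using v(1) by auto
  define r where "r = quad_form X v / quad_form Y v"
  have eq: "quad_form X v = r * quad_form Y v"
    using posY[OF \<open>v \<noteq> 0\<close>] by (simp add: r_def)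
  have unit_le: "quad_form X w \<le> r * quad_form Y w" if "norm w = 1" for w
    using v(2)[OF that] pos_def_mat_unit_pos[OF assms(2) that]
    by (simp add: r_def[symmetric] divide_le_eq)
  have le: "quad_form X w \<le> r * quad_form Y w" for w
  proof (cases "w = 0")
    case False
    define u where "u = w /\<^sub>R norm w"
    have w: "norm w *\<^sub>R u = w" and "norm u = 1" using False by (auto simp: u_def)
    then have "(norm w)\<^sup>2 * quad_form X u \<le> (norm w)\<^sup>2 * (r * quad_form Y u)"
      by (intro mult_left_mono unit_le) auto
    then show ?thesis
      using quad_form_scaleR_right[of "norm w" u X] quad_form_scaleR_right[of "norm w" u Y]
      unfolding w by (simp add: mult.left_commute)
  qed simp
  have "(X - r *\<^sub>R Y) *v v = 0"
  proof (rule neg_semidef_isotropic_imp_kernel)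
    show "symmetric_mat (X - r *\<^sub>R Y)"
      using assms(1) symY by (simp add: symmetric_mat_def transpose_def vec_eq_iff)
  next
    show "quad_form (X - r *\<^sub>R Y) w \<le> 0" for w
      unfolding quad_form_diff quad_form_scaleR using le[of w] by simp
    show "quad_form (X - r *\<^sub>R Y) v = 0"
      unfolding quad_form_diff quad_form_scaleR using eq by simp
  qed
  then have "X *v v = r *\<^sub>R (Y *v v)"
    by (simp add: matrix_vector_mult_diff_rdistrib scaleR_matrix_vector_assoc)
  then have "gen_eigenvalue X Y r"
    unfolding gen_eigenvalue_def using \<open>v \<noteq> 0\<close> by blast
  moreover have "k \<le> r" if k: "gen_eigenvalue X Y k" for k
  proof -
    obtain w where "w \<noteq> 0" "X *v w = k *\<^sub>R (Y *v w)"
      using k by (auto simp: gen_eigenvalue_def)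
    then have "k * quad_form Y w \<le> r * quad_form Y w" using le[of w] by simp
    then show ?thesis using posY[OF \<open>w \<noteq> 0\<close>] by simp
  qed
  ultimately have "Max {l. gen_eigenvalue X Y l} = r"
    by (intro Max_eqI finite_gen_eigenvalues assms(1,2)) blast+
  then have lr: "l = r"
    unfolding assms(3) max_gen_eigenvalue_def .
  show "quad_form X w \<le> l * quad_form Y w"
    unfolding lr by (rule le)
  show "\<exists>v. norm v = 1 \<and> quad_form X v = l * quad_form Y v"
    unfolding lr using eq v(1) by blast
qed

section \<open>Bounds, perturbation and extrapolation of the largest generalized eigenvalue\<close>

lemma abs_max_gen_eigenvalue_le:
  assumes "symmetric_mat X" "pos_def_mat Y"
    and "0 < b" and b: "\<And>v. norm v = 1 \<Longrightarrow> b \<le> quad_form Y v"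
  shows "\<bar>max_gen_eigenvalue X Y\<bar> \<le> norm X / b"
proof -
  obtain v where v: "norm v = 1" "quad_form X v = max_gen_eigenvalue X Y * quad_form Y v"
    using max_gen_eigenvalue_attained[OF assms(1,2)] by auto
  have "\<bar>max_gen_eigenvalue X Y\<bar> * b \<le> \<bar>max_gen_eigenvalue X Y\<bar> * quad_form Y v"
    by (intro mult_left_mono b v) auto
  also have "\<dots> = \<bar>quad_form X v\<bar>" using b[OF v(1)] \<open>0 < b\<close> v(2) by (simp add: abs_mult)
  also have "\<dots> \<le> norm X" by (rule abs_quad_form_le[OF v(1)])
  finally show ?thesis using \<open>0 < b\<close> by (simp add: le_divide_eq)
qed

text \<open>A maximizer for \<open>(X, Y)\<close> is tested in the Rayleigh inequality of
  \<open>(X', Y')\<close>. The bound is one-sided; exchanging the two pairs gives the Lipschitz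
  estimate once \<open>\<bar>l\<bar>\<close> is bounded.\<close>

lemma max_gen_eigenvalue_diff_le:
  assumes "symmetric_mat X" "pos_def_mat Y" "symmetric_mat X'" "pos_def_mat Y'"
    and "0 < b" and b: "\<And>v. norm v = 1 \<Longrightarrow> b \<le> quad_form Y' v"
  defines "l \<equiv> max_gen_eigenvalue X Y" and "l' \<equiv> max_gen_eigenvalue X' Y'"
  shows "l - l' \<le> (norm (X - X') + \<bar>l\<bar> * norm (Y - Y')) / b"
proof (cases "l' \<le> l")
  case True
  obtain v where v: "norm v = 1" "quad_form X v = l * quad_form Y v"
    using max_gen_eigenvalue_attained[OF assms(1,2)] l_def by auto
  have "(l - l') * b \<le> (l - l') * quad_form Y' v"
    using True by (intro mult_left_mono b v) auto
  also have "\<dots> \<le> l * quad_form Y' v - quad_form X' v"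
    using max_gen_eigenvalue_ge[OF assms(3,4), of v] l'_def by (simp add: algebra_simps)
  also have "\<dots> = quad_form (X - X') v - l * quad_form (Y - Y') v"
    using v(2) unfolding quad_form_diff by (simp add: algebra_simps)
  also have "\<dots> \<le> \<bar>quad_form (X - X') v\<bar> + \<bar>l\<bar> * \<bar>quad_form (Y - Y') v\<bar>"
    unfolding abs_mult[symmetric] by linarith
  also have "\<dots> \<le> norm (X - X') + \<bar>l\<bar> * norm (Y - Y')"
    by (intro add_mono mult_left_mono abs_quad_form_le v) auto
  finally show ?thesis using \<open>0 < b\<close> by (simp add: le_divide_eq)
next
  case False
  moreover have "0 \<le> (norm (X - X') + \<bar>l\<bar> * norm (Y - Y')) / b" using \<open>0 < b\<close> by simp
  ultimately show ?thesis by linarith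
qed

text \<open>The form of \<open>X - l *\<^sub>R Y\<close> vanishes at a maximizer \<open>v\<close>
  for \<open>(X, Y)\<close>. Hence that of \<open>X'' - l *\<^sub>R Y''\<close> at \<open>v\<close>
  is \<open>s\<close> times that of \<open>l *\<^sub>R Y' - X'\<close>, which is at least
  \<open>(l - l') * b\<close>.\<close>

lemma max_gen_eigenvalue_extrapolate:
  fixes X Y X' Y' :: "real ^ 'n ^ 'n" and s b :: real
  assumes "symmetric_mat X" "pos_def_mat Y" "symmetric_mat X'" "pos_def_mat Y'"
  defines "X'' \<equiv> X + s *\<^sub>R (X - X')" and "Y'' \<equiv> Y + s *\<^sub>R (Y - Y')"
  assumes "symmetric_mat X''" "pos_def_mat Y''"
  defines "l \<equiv> max_gen_eigenvalue X Y" and "l' \<equiv> max_gen_eigenvalue X' Y'"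
    and "l'' \<equiv> max_gen_eigenvalue X'' Y''"
  assumes "0 \<le> s" "l' \<le> l" "0 < b" and b: "\<And>v. norm v = 1 \<Longrightarrow> b \<le> quad_form Y' v"
  shows "s * ((l - l') * b) \<le> (l'' - l) * norm Y''"
proof -
  obtain v where v: "norm v = 1" "quad_form X v = l * quad_form Y v"
    using max_gen_eigenvalue_attained[OF assms(1,2)] l_def by auto
  have X': "quad_form X' v \<le> l' * quad_form Y' v"
    using max_gen_eigenvalue_ge[OF assms(3,4)] l'_def by auto
  have X'': "quad_form X'' v \<le> l'' * quad_form Y'' v"
    using max_gen_eigenvalue_ge[OF assms(7,8)] l''_def by auto
  have "s * ((l - l') * b) \<le> s * ((l - l') * quad_form Y' v)"
    using \<open>0 \<le> s\<close> \<open>l' \<le> l\<close> by (intro mult_left_mono b v) auto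
  also have "\<dots> \<le> s * (l * quad_form Y' v - quad_form X' v)"
    using X' \<open>0 \<le> s\<close> by (intro mult_left_mono) (auto simp: algebra_simps)
  also have "\<dots> = quad_form X'' v - l * quad_form Y'' v"
    unfolding X''_def Y''_def quad_form_add quad_form_scaleR quad_form_diff v(2)
    by (simp add: algebra_simps)
  also have "\<dots> \<le> (l'' - l) * quad_form Y'' v"
    using X'' by (simp add: algebra_simps)
  finally have *: "s * ((l - l') * b) \<le> (l'' - l) * quad_form Y'' v" .
  have pos: "0 < quad_form Y'' v"
    using \<open>pos_def_mat Y''\<close> v(1) by (rule pos_def_mat_unit_pos)
  \<comment> \<open>Enlarging the form of \<open>Y''\<close> to \<open>norm Y''\<close> is only
    legitimate once \<open>l'' - l\<close> is known to be nonnegative.\<close>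
  have "0 \<le> (l'' - l) * quad_form Y'' v"
    by (rule order_trans[OF _ *]) (use \<open>0 \<le> s\<close> \<open>l' \<le> l\<close> \<open>0 < b\<close> in simp)
  then have "0 \<le> l'' - l" using pos by (simp add: zero_le_mult_iff)
  then have "(l'' - l) * quad_form Y'' v \<le> (l'' - l) * norm Y''"
    using abs_quad_form_le[OF v(1), of Y''] by (intro mult_left_mono) auto
  with * show ?thesis by linarith
qed

section \<open>Pseudoconvexity\<close>

lemma open_pos_orthant: "open (pos_orthant :: (real ^ 'm) set)"
proof -
  have *: "pos_orthant = (\<Inter>e. {x :: real ^ 'm. x $ e > 0})"
    by (auto simp: pos_orthant_def)
  show ?thesis
    unfolding * by (intro open_INT ballI open_halfspace_component_gt_cart) simp
qed

lemma convex_pos_orthant: "convex (pos_orthant :: (real ^ 'm) set)"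
proof (rule convexI)
  fix x y :: "real ^ 'm" and u v :: real
  assume "x \<in> pos_orthant" "y \<in> pos_orthant" "0 \<le> u" "0 \<le> v" "u + v = 1"
  then show "u *\<^sub>R x + v *\<^sub>R y \<in> pos_orthant"
    unfolding pos_orthant_def
    by (auto intro!: convex_bound_lt[where a = 0, simplified] add_nonneg_pos simp: less_le)
      (smt (verit) mult_nonneg_nonneg mult_pos_pos)
qed

lemma pos_orthant_nonempty: "(pos_orthant :: (real ^ 'm) set) \<noteq> {}"
proof -
  have "(\<chi> e. 1) \<in> (pos_orthant :: (real ^ 'm) set)" by (simp add: pos_orthant_def)
  then show ?thesis by blast
qed

section \<open>Tools from nonsmooth analysis\<close>

lemma locally_lipschitz_on_imp_continuous_on:
  assumes "open D" "locally_lipschitz_on D f"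
  shows "continuous_on D f"
proof (rule continuous_at_imp_continuous_on, rule ballI)
  fix x assume "x \<in> D"
  then obtain u L where u: "u > 0" "L-lipschitz_on (cball x u \<inter> D) f"
    using assms(2) by (auto simp: locally_lipschitz_on_def)
  have "continuous_on (ball x u \<inter> D) f"
    by (rule continuous_on_subset[OF lipschitz_on_continuous_on[OF u(2)]]) auto
  then show "isCont f x"
    using assms(1) u(1) \<open>x \<in> D\<close> continuous_on_eq_continuous_at[of "ball x u \<inter> D" f]
    by (simp add: open_Int)
qed

lemma gderiv_directional:
  assumes "GDERIV f x :> G"
  shows "((\<lambda>s. f (x + s *\<^sub>R d)) has_real_derivative d \<bullet> G) (at 0)"
proof -
  have f: "(f has_derivative (\<lambda>h. h \<bullet> G)) (at (x + 0 *\<^sub>R d))"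
    using assms by (simp add: gderiv_def)
  have "((\<lambda>s. x + s *\<^sub>R d) has_derivative (\<lambda>s. s *\<^sub>R d)) (at 0)"
    by (auto intro!: derivative_eq_intros)
  from has_derivative_compose[OF this f] show ?thesis
    by (rule has_derivative_imp_has_field_derivative) simp
qed

text \<open>An open half-space is convex, so it contains the hull as soon as it contains the limits
  of gradients.\<close>

lemma clarke_subdifferential_halfspaceI:
  assumes "g \<in> clarke_subdifferential D f x"
    and lim: "\<And>X G g. \<lbrakk>\<And>i::nat. X i \<in> D; \<And>i. GDERIV f (X i) :> G i; X \<longlonglongrightarrow> x; G \<longlonglongrightarrow> g\<rbrakk>
      \<Longrightarrow> g \<bullet> d < c"
  shows "g \<bullet> d < c"
proof -
  have "clarke_subdifferential D f x \<subseteq> {g. d \<bullet> g < c}"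
    unfolding clarke_subdifferential_def
  proof (rule hull_minimal)
    show "convex {g. d \<bullet> g < c}" by (rule convex_halfspace_lt)
  qed (use lim in \<open>auto simp: inner_commute\<close>)
  then show ?thesis using assms(1) by (auto simp: inner_commute)
qed

theorem theorem6:
  fixes A B :: "real ^ 'm \<Rightarrow> real ^ 'n ^ 'n"
    and A0 B0 :: "real ^ 'n ^ 'n"
    and Ae Be :: "'m \<Rightarrow> real ^ 'n ^ 'n"
  assumes "symmetric_mat A0" and "\<And>e. symmetric_mat (Ae e)"
    and "symmetric_mat B0" and "\<And>e. symmetric_mat (Be e)"
    and "\<And>x. x \<in> pos_orthant \<Longrightarrow> A x = A0 + (\<Sum>e\<in>UNIV. x $ e *\<^sub>R Ae e)"
    and "\<And>x. x \<in> pos_orthant \<Longrightarrow> B x = B0 + (\<Sum>e\<in>UNIV. x $ e *\<^sub>R Be e)"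
    and "\<And>x. x \<in> pos_orthant \<Longrightarrow> pos_def_mat (B x)"
  shows "pseudoconvex_on pos_orthant (\<lambda>x. max_gen_eigenvalue (A x) (B x))"
proof -
  define f where "f x = max_gen_eigenvalue (A x) (B x)" for x
  define LA where "LA h = (\<Sum>e\<in>UNIV. h $ e *\<^sub>R Ae e)" for h :: "real ^ 'm"
  define LB where "LB h = (\<Sum>e\<in>UNIV. h $ e *\<^sub>R Be e)" for h :: "real ^ 'm"
  have linA: "linear LA" and linB: "linear LB"
    unfolding LA_def LB_def
    by (rule linearI; simp add: scaleR_add_left sum.distrib scaleR_sum_right)+
  have A: "A x = A0 + LA x" and B: "B x = B0 + LB x" if "x \<in> pos_orthant" for x
    using that assms(5,6) by (auto simp: LA_def LB_def)
  have symA: "symmetric_mat (A x)" if "x \<in> pos_orthant" for x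
    using assms(1,2) unfolding A[OF that] LA_def
    by (simp add: symmetric_mat_def transpose_def vec_eq_iff)
  note pdB = assms(7)
  obtain CA where CA: "CA > 0" "\<And>h. norm (LA h) \<le> CA * norm h"
    using linear_bounded_pos[OF linA] by (auto simp: mult.commute)
  obtain CB where CB: "CB > 0" "\<And>h. norm (LB h) \<le> CB * norm h"
    using linear_bounded_pos[OF linB] by (auto simp: mult.commute)
  have dA: "norm (A x - A y) \<le> CA * dist x y" and dB: "norm (B x - B y) \<le> CB * dist x y"
    if "x \<in> pos_orthant" "y \<in> pos_orthant" for x y
    using CA(2)[of "x - y"] CB(2)[of "x - y"] that
    by (simp_all add: A B dist_norm linear_diff[OF linA] linear_diff[OF linB])

  have lip: "locally_lipschitz_on pos_orthant f"
    unfolding locally_lipschitz_on_def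
  proof
    fix x :: "real ^ 'm" assume x: "x \<in> pos_orthant"
    obtain b where b: "b > 0" "\<And>v. norm v = 1 \<Longrightarrow> b \<le> quad_form (B x) v"
      using pos_def_mat_lower_bound[OF pdB[OF x]] by blast
    \<comment> \<open>On a ball of this radius \<open>B\<close> moves by at most
      \<open>b / 2\<close> in norm, so half of the lower bound at \<open>x\<close> survives.\<close>
    define u where "u = b / (2 * CB)"
    have "u > 0" using b(1) CB(1) by (simp add: u_def)
    let ?S = "cball x u \<inter> pos_orthant"
    have low: "b / 2 \<le> quad_form (B y) v" if "y \<in> ?S" "norm v = 1" for y v
    proof -
      have "CB * dist x y \<le> CB * u" using that CB(1) by (intro mult_left_mono) auto
      also have "\<dots> = b / 2" using CB(1) by (simp add: u_def)
      finally have "norm (B x - B y) \<le> b / 2" using dB[of x y] x that by auto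
      then have "quad_form (B x - B y) v \<le> b / 2" using abs_quad_form_le[OF that(2), of "B x - B y"] by linarith
      then show ?thesis using b(2)[OF that(2)] unfolding quad_form_diff by linarith
    qed
    \<comment> \<open>The numerator bounds \<open>norm (A y)\<close> on the ball, and
      \<open>b / 2\<close> bounds the form of \<open>B y\<close> from below.\<close>
    define K where "K = (norm (A x) + CA * u) / (b / 2)"
    have "K \<ge> 0" using b(1) CA(1) \<open>u > 0\<close> by (simp add: K_def)
    have bound: "\<bar>f y\<bar> \<le> K" if "y \<in> ?S" for y
    proof -
      have "CA * dist y x \<le> CA * u" using that CA(1) by (intro mult_left_mono) (auto simp: dist_commute)
      then have "norm (A y) \<le> norm (A x) + CA * u"
        using dA[of y x] norm_triangle_sub[of "A y" "A x"] x that by auto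
      moreover have "\<bar>f y\<bar> \<le> norm (A y) / (b / 2)"
        unfolding f_def using that b(1) low by (intro abs_max_gen_eigenvalue_le symA pdB) auto
      ultimately show ?thesis
        unfolding K_def using b(1) by (meson divide_right_mono half_gt_zero less_imp_le order_trans)
    qed
    define L where "L = (CA + K * CB) / (b / 2)"
    have "L \<ge> 0" using b(1) CA(1) CB(1) \<open>K \<ge> 0\<close> by (simp add: L_def)
    have diff: "f y - f z \<le> L * dist y z" if "y \<in> ?S" "z \<in> ?S" for y z
    proof -
      have "f y - f z \<le> (norm (A y - A z) + \<bar>f y\<bar> * norm (B y - B z)) / (b / 2)"
        unfolding f_def using that b(1) low
        by (intro max_gen_eigenvalue_diff_le symA pdB) auto
      also have "\<dots> \<le> (CA * dist y z + K * (CB * dist y z)) / (b / 2)"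
        using that b(1) \<open>K \<ge> 0\<close>
        by (intro divide_right_mono add_mono mult_mono dA dB bound) auto
      also have "\<dots> = L * dist y z" by (simp add: L_def field_simps)
      finally show ?thesis .
    qed
    have "L-lipschitz_on ?S f"
    proof (rule lipschitz_onI)
      fix y z assume "y \<in> ?S" "z \<in> ?S"
      then show "dist (f y) (f z) \<le> L * dist y z"
        using diff[of y z] diff[of z y] by (auto simp: dist_real_def dist_commute abs_le_iff)
    qed fact
    then show "\<exists>u>0. \<exists>L. L-lipschitz_on (cball x u \<inter> pos_orthant) f"
      using \<open>u > 0\<close> by blast
  qed
  note cont = locally_lipschitz_on_imp_continuous_on[OF open_pos_orthant lip]

  have contB: "isCont B x" if "x \<in> pos_orthant" for x
  proof -
    \<comment> \<open>The affine formula for \<open>B\<close> is given only on the orthant, so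
      continuity is transferred through equality near \<open>x\<close>.\<close>
    have "isCont (\<lambda>x. B0 + LB x) x"
      using linB by (intro continuous_intros linear_continuous_at linear_conv_bounded_linear[THEN iffD1])
    moreover have "\<forall>\<^sub>F y in nhds x. B y = B0 + LB y"
      using eventually_nhds_in_open[OF open_pos_orthant that] by eventually_elim (rule B)
    ultimately show ?thesis by (simp add: isCont_cong[of B])
  qed

  \<comment> \<open>The bound \<open>b\<close> depends on \<open>y\<close> alone, and both sides
    depend continuously on \<open>x\<close>, \<open>G\<close>, \<open>f x\<close> and
    \<open>B x\<close>. The inequality therefore survives limits along points tending to
    \<open>x\<close>.\<close>
  have smooth: "(f x - f y) * b \<le> - (G \<bullet> (y - x)) * norm (B x)"
    if x: "x \<in> pos_orthant" and y: "y \<in> pos_orthant" and G: "GDERIV f x :> G" and "f y \<le> f x"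
      and b: "0 < b" "\<And>v. norm v = 1 \<Longrightarrow> b \<le> quad_form (B y) v" for x y G b
  proof -
    let ?p = "\<lambda>s. x + s *\<^sub>R (x - y)"
    have "(?p \<longlongrightarrow> ?p 0) (at_right 0)"
      by (intro tendsto_intros)
    then have p: "(?p \<longlongrightarrow> x) (at_right 0)" by simp
    have "((\<lambda>s. f (?p s)) has_real_derivative (x - y) \<bullet> G) (at 0)"
      by (rule gderiv_directional[OF G])
    then have "((\<lambda>s. (f (?p s) - f x) / s) \<longlongrightarrow> (x - y) \<bullet> G) (at_right 0)"
      by (auto simp: has_field_derivative_iff intro: filterlim_mono[OF _ order_refl at_le])
    moreover have "((\<lambda>s. norm (B (?p s))) \<longlongrightarrow> norm (B x)) (at_right 0)"
      by (intro tendsto_norm isCont_tendsto_compose[OF contB[OF x] p])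
    ultimately have lim: "((\<lambda>s. (f (?p s) - f x) / s * norm (B (?p s))) \<longlongrightarrow> (x - y) \<bullet> G * norm (B x)) (at_right 0)"
      by (rule tendsto_mult)
    have "\<forall>\<^sub>F s in at_right 0. ?p s \<in> pos_orthant"
      using topological_tendstoD[OF p open_pos_orthant x] .
    moreover have "\<forall>\<^sub>F s::real in at_right 0. s > 0" by (rule eventually_at_right_less)
    ultimately have "\<forall>\<^sub>F s in at_right 0. (f x - f y) * b \<le> (f (?p s) - f x) / s * norm (B (?p s))"
    proof eventually_elim
      case (elim s)
      \<comment> \<open>Constant terms cancel in \<open>A x - A y\<close>, so the pair at
        \<open>?p s\<close> is exactly the extrapolated pair \<open>(X'', Y'')\<close>.\<close>
      have eqA: "A (?p s) = A x + s *\<^sub>R (A x - A y)"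
        using elim x y by (simp add: A linear_add[OF linA] linear_diff[OF linA] linear_scale[OF linA])
      have eqB: "B (?p s) = B x + s *\<^sub>R (B x - B y)"
        using elim x y by (simp add: B linear_add[OF linB] linear_diff[OF linB] linear_scale[OF linB])
      have "s * ((f x - f y) * b) \<le> (f (?p s) - f x) * norm (B (?p s))"
        using max_gen_eigenvalue_extrapolate[OF symA[OF x] pdB[OF x] symA[OF y] pdB[OF y], of s b]
          symA[OF elim(1)] pdB[OF elim(1)] elim(2) b \<open>f y \<le> f x\<close>
        by (simp add: f_def eqA eqB)
      then show ?case using elim(2) by (simp add: field_simps)
    qed
    then have "(f x - f y) * b \<le> (x - y) \<bullet> G * norm (B x)"
      by (rule tendsto_lowerbound[OF lim]) simp
    moreover have "(x - y) \<bullet> G = - (G \<bullet> (y - x))"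
      by (simp add: inner_diff_left inner_diff_right inner_commute)
    ultimately show ?thesis by simp
  qed

  have pseudo: "g \<bullet> (y - x) < 0"
    if x: "x \<in> pos_orthant" and y: "y \<in> pos_orthant"
      and "g \<in> clarke_subdifferential pos_orthant f x" and less: "f y < f x" for x y g
    using that(3)
  proof (rule clarke_subdifferential_halfspaceI)
    fix X G g
    assume XG: "\<And>i::nat. X i \<in> pos_orthant" "\<And>i. GDERIV f (X i) :> G i" "X \<longlonglongrightarrow> x" "G \<longlonglongrightarrow> g"
    obtain b where b: "b > 0" "\<And>v. norm v = 1 \<Longrightarrow> b \<le> quad_form (B y) v"
      using pos_def_mat_lower_bound[OF pdB[OF y]] by blast
    have fX: "(\<lambda>i. f (X i)) \<longlonglongrightarrow> f x"
      using cont open_pos_orthant x XG(3)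
      by (metis continuous_on_eq_continuous_at isCont_tendsto_compose)
    have BX: "(\<lambda>i. B (X i)) \<longlonglongrightarrow> B x"
      by (rule isCont_tendsto_compose[OF contB[OF x] XG(3)])
    \<comment> \<open>By continuity \<open>f y < f (X i)\<close> holds for all large
      \<open>i\<close>, so \<open>smooth\<close> applies to a tail of the sequence.\<close>
    have "\<forall>\<^sub>F i in sequentially. (f (X i) - f y) * b \<le> - (G i \<bullet> (y - X i)) * norm (B (X i))"
      using order_tendstoD(1)[OF fX less]
      by eventually_elim (use smooth XG(1,2) y b in \<open>simp add: less_imp_le\<close>)
    then have "(f x - f y) * b \<le> - (g \<bullet> (y - x)) * norm (B x)"
      by (intro tendsto_le[OF sequentially_bot]) (auto intro!: tendsto_intros fX BX XG)
    \<comment> \<open>The limit inequality is not strict, but its left side is positive; as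
      \<open>norm (B x)\<close> is nonnegative, the sign falls on the inner product.\<close>
    moreover have "0 < (f x - f y) * b" using less b(1) by simp
    ultimately have "0 < - (g \<bullet> (y - x)) * norm (B x)" by linarith
    then show "g \<bullet> (y - x) < 0" by (auto simp: zero_less_mult_iff mult_less_0_iff)
  qed

  have "pseudoconvex_on pos_orthant f"
    unfolding pseudoconvex_on_def
    using open_pos_orthant convex_pos_orthant pos_orthant_nonempty lip pseudo by blast
  then show ?thesis by (simp only: f_def[abs_def])
qed

end
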